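(* Let $G^c$ be a $2$-edge-coloured multigraph on $n \geq 8$ vertices, coloured with the two colours $\{r,b\}$, and let $m$ be its number of edges. If $m\geq \binom{n}{2} + \binom{n-2}{2} + 1$, then $G^c$ has a proper Hamiltonian path.
   Context: A $c$-edge-coloured multigraph $G^c$ is a multigraph on $n$ vertices in which every edge receives one colour from $\{1,\ldots,c\}$ and no two parallel edges joining the same pair of vertices have the same colour; thus between two vertices there is at most one edge of each colour, and $m$ counts all edges (with multiplicity). A path is properly edge-coloured (proper) if any two consecutive edges of it have different colours. A proper Hamiltonian path is a proper path containing all vertices. *)

theory Defs
  imports Complex_Main
begin

text \<open>Multigraphs are undirected; \<open>ends G e\<close> is the set of the two endpoints of \<open>e\<close>, so parallel
  edges are distinct edges with the same set of endpoints.\<close>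

record ('v, 'e, 'c) ec_multigraph =
  verts :: "'v set"
  edges :: "'e set"
  ends :: "'e \<Rightarrow> 'v set"
  colour :: "'e \<Rightarrow> 'c"

text \<open>\<open>C\<close> is the set of available colours; not every colour of \<open>C\<close> has to be used. The condition
  \<open>card (ends G e) = 2\<close> excludes loops.\<close>

locale edge_coloured_multigraph =
  fixes G :: "('v, 'e, 'c) ec_multigraph" (structure)
    and C :: "'c set"
  assumes finite_verts: "finite (verts G)"
    and finite_edges: "finite (edges G)"
    and ends_subset: "e \<in> edges G \<Longrightarrow> ends G e \<subseteq> verts G"
    and card_ends: "e \<in> edges G \<Longrightarrow> card (ends G e) = 2"
    and colour_in: "e \<in> edges G \<Longrightarrow> colour G e \<in> C"
    and parallel_colours: "\<lbrakk>e \<in> edges G; f \<in> edges G; e \<noteq> f; ends G e = ends G f\<rbrakk>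
      \<Longrightarrow> colour G e \<noteq> colour G f"

text \<open>Since parallel edges may differ in colour, a path is given by its list \<open>vs\<close> of vertices
  together with its list \<open>es\<close> of edges.\<close>

definition is_path :: "('v, 'e, 'c) ec_multigraph \<Rightarrow> 'v list \<Rightarrow> 'e list \<Rightarrow> bool" where
  "is_path G vs es \<longleftrightarrow>
     length vs = Suc (length es) \<and> distinct vs \<and> set vs \<subseteq> verts G \<and> set es \<subseteq> edges G \<and>
     (\<forall>i < length es. ends G (es ! i) = {vs ! i, vs ! Suc i})"

definition is_proper_path :: "('v, 'e, 'c) ec_multigraph \<Rightarrow> 'v list \<Rightarrow> 'e list \<Rightarrow> bool" where
  "is_proper_path G vs es \<longleftrightarrow>
     is_path G vs es \<and>
     (\<forall>i. Suc i < length es \<longrightarrow> colour G (es ! i) \<noteq> colour G (es ! Suc i))"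

definition has_proper_hamiltonian_path :: "('v, 'e, 'c) ec_multigraph \<Rightarrow> bool" where
  "has_proper_hamiltonian_path G \<longleftrightarrow> (\<exists>vs es. is_proper_path G vs es \<and> set vs = verts G)"

end

theory Submission
  imports Defs
begin

text \<open>At most \<open>2n - 4\<close> coloured edges are missing from the complete 2-coloured multigraph. The proof is by
  induction from \<open>n - 2\<close> to \<open>n\<close> vertices. If \<open>x\<close> and \<open>y\<close> are joined in both colours, a proper Hamiltonian path
  of \<open>G - {x, y}\<close> can absorb the edge \<open>xy\<close> inside an edge or at an end; each of these possibilities
  fails only if two edges at \<open>x\<close> or \<open>y\<close> are missing, and different possibilities need different missing
  edges, \<open>2n - 2\<close> in total. So it suffices that enough missing edges disappear with \<open>x\<close> and \<open>y\<close>, which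
  holds if \<open>x\<close> misses as many edges as possible and has some neighbour in both colours. If \<open>x\<close> has
  no such neighbour, then \<open>x\<close> is responsible for at least \<open>n - 1\<close> missing edges, and \<open>G - x\<close> is so dense
  that either a path starting at \<open>x\<close> can be built greedily or a suitable neighbour of \<open>x\<close> in a single
  colour can play the role of \<open>y\<close>.\<close>

text \<open>Colours are Booleans here; in \<open>alt E c vs\<close> the first edge has colour \<open>c\<close>, and a single vertex
  is a path for either \<open>c\<close>.\<close>

fun alt :: "(bool \<Rightarrow> 'v \<Rightarrow> 'v \<Rightarrow> bool) \<Rightarrow> bool \<Rightarrow> 'v list \<Rightarrow> bool" where
  "alt E c (u # v # vs) \<longleftrightarrow> E c u v \<and> alt E (\<not> c) (v # vs)"
| "alt E c vs \<longleftrightarrow> True"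

definition ham :: "(bool \<Rightarrow> 'v \<Rightarrow> 'v \<Rightarrow> bool) \<Rightarrow> 'v set \<Rightarrow> bool" where
  "ham E A \<longleftrightarrow> (\<exists>c vs. alt E c vs \<and> distinct vs \<and> set vs = A)"

section \<open>Degrees in the multigraph of missing edges\<close>

locale two_coloured =
  fixes E :: "bool \<Rightarrow> 'v \<Rightarrow> 'v \<Rightarrow> bool"
  assumes sym: "E c u v \<longleftrightarrow> E c v u"
begin

definition missing :: "bool \<Rightarrow> 'v \<Rightarrow> 'v \<Rightarrow> nat" where
  "missing c u v = of_bool (\<not> E c u v)"

definition colour_codeg :: "bool \<Rightarrow> 'v set \<Rightarrow> 'v \<Rightarrow> nat" where
  "colour_codeg c A x = (\<Sum>u\<in>A - {x}. missing c x u)"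

definition codeg :: "'v set \<Rightarrow> 'v \<Rightarrow> nat" where
  "codeg A x = colour_codeg True A x + colour_codeg False A x"

text \<open>Every missing edge is counted twice, once from each end.\<close>

definition total_codeg :: "'v set \<Rightarrow> nat" where
  "total_codeg A = (\<Sum>x\<in>A. codeg A x)"

lemma missing_sym: "missing c u v = missing c v u"
  by (simp add: missing_def sym)

lemma codeg_colour: "codeg A x = colour_codeg c A x + colour_codeg (\<not> c) A x"
  by (cases c) (auto simp: codeg_def)

lemma colour_codeg_le_codeg: "colour_codeg c A x \<le> codeg A x"
  by (simp add: codeg_colour[of A x c])

lemma colour_codeg_remove:
  assumes "finite A" "x \<in> A" "x \<noteq> y"
  shows "colour_codeg c A y = missing c y x + colour_codeg c (A - {x}) y"
proof -
  have "A - {y} - {x} = A - {x} - {y}" by auto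
  then show ?thesis
    using assms by (simp add: colour_codeg_def sum.remove[of "A - {y}" x])
qed

lemma total_codeg_remove:
  assumes "finite A" "x \<in> A"
  shows "total_codeg A = 2 * codeg A x + total_codeg (A - {x})"
proof -
  have *: "codeg A y = (missing True x y + missing False x y) + codeg (A - {x}) y" if "y \<in> A - {x}" for y
    using that assms colour_codeg_remove[of A x y] missing_sym[of _ x y] by (auto simp: codeg_def)
  have "total_codeg A = codeg A x + (\<Sum>y\<in>A - {x}. codeg A y)"
    using assms by (simp add: total_codeg_def sum.remove)
  also have "(\<Sum>y\<in>A - {x}. codeg A y)
      = (\<Sum>y\<in>A - {x}. (missing True x y + missing False x y) + codeg (A - {x}) y)"
    by (rule sum.cong) (use * in auto)
  also have "\<dots> = codeg A x + total_codeg (A - {x})"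
    by (simp add: sum.distrib codeg_def colour_codeg_def total_codeg_def)
  finally show ?thesis by simp
qed

lemma card_neighbours:
  assumes "finite A" "x \<in> A"
  shows "card {u \<in> A - {x}. E c x u} + colour_codeg c A x = card A - 1"
proof -
  have "colour_codeg c A x = card {u \<in> A - {x}. \<not> E c x u}"
    unfolding colour_codeg_def missing_def using assms by (subst sum_of_bool_eq) (auto simp: Int_def)
  moreover have "card (A - {x}) = card {u \<in> A - {x}. E c x u} + card {u \<in> A - {x}. \<not> E c x u}"
  proof -
    have "{u \<in> A - {x}. E c x u} \<union> {u \<in> A - {x}. \<not> E c x u} = A - {x}" by blast
    moreover have "card ({u \<in> A - {x}. E c x u} \<union> {u \<in> A - {x}. \<not> E c x u})
        = card {u \<in> A - {x}. E c x u} + card {u \<in> A - {x}. \<not> E c x u}"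
      using assms(1) by (intro card_Un_disjoint) auto
    ultimately show ?thesis by simp
  qed
  ultimately show ?thesis using assms by simp
qed

section \<open>Greedy alternating paths\<close>

text \<open>The hypotheses reproduce themselves when the start vertex \<open>y\<close> is deleted and \<open>Y\<close> is replaced by the
  \<open>c\<close>-neighbours of \<open>y\<close>: missing \<open>c\<close>-edges at \<open>y\<close> shrink the new \<open>Y\<close> but are deleted with \<open>y\<close>. In the bound
  \<open>2 * (card A - 2)\<close> the truncated subtraction covers singletons.\<close>

lemma greedy_path:
  assumes "finite A" "A \<noteq> {}" "Y \<subseteq> A" "total_codeg A + 2 \<le> 2 * card Y" "total_codeg A \<le> 2 * (card A - 2)"
  shows "\<exists>v vs. v \<in> Y \<and> alt E c (v # vs) \<and> distinct (v # vs) \<and> set (v # vs) = A"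
  using assms
proof (induction "card A" arbitrary: A Y c rule: less_induct)
  case less
  have Yne: "Y \<noteq> {}" and finY: "finite Y" and YA: "card Y \<le> card A"
    using less.prems finite_subset[of Y A] card_mono[of A Y] by auto
  show ?case
  proof (cases "card A = 1")
    case True
    then obtain v where "A = {v}" by (auto simp: card_1_singleton_iff)
    then show ?thesis using Yne less.prems by (intro exI[of _ v] exI[of _ "[]"]) auto
  next
    case False
    moreover have "card A \<noteq> 0" using less.prems by simp
    ultimately have A2: "card A \<ge> 2" by linarith
    \<comment> \<open>Deleting \<open>y\<close> can lower the bound by 2, so when a positive
      \<open>total_codeg A\<close> is close to the bound, \<open>y\<close> itself must miss an edge.
      If no vertex of \<open>Y\<close> does, then \<open>Y\<close> omits at most one vertex, and
      that vertex cannot contain both ends of a missing edge.\<close>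
    have "\<exists>y\<in>Y. total_codeg A = 0 \<or> total_codeg A \<le> 2 * (card A - 3) \<or> codeg A y \<ge> 1"
    proof (rule ccontr)
      assume "\<not> ?thesis"
      then have zero: "\<And>y. y \<in> Y \<Longrightarrow> codeg A y = 0" and big: "total_codeg A > 0" "total_codeg A > 2 * (card A - 3)"
        using Yne by (auto simp: not_less_eq_eq)
      have "card Y + 1 \<ge> card A" using big less.prems by linarith
      then have "card (A - Y) \<le> 1"
        using less.prems finY by (simp add: card_Diff_subset)
      have tot: "total_codeg A = (\<Sum>x\<in>A - Y. codeg A x)"
        unfolding total_codeg_def using zero less.prems by (intro sum.mono_neutral_right) auto
      with big have "A - Y \<noteq> {}" by (metis less_irrefl sum.empty)
      with \<open>card (A - Y) \<le> 1\<close> obtain z where z: "A - Y = {z}"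
        using less.prems by (metis card_0_eq card_1_singletonE finite_Diff le_neq_implies_less less_one)
      then have "z \<in> A" by auto
      from total_codeg_remove[OF less.prems(1) this] tot z big show False by simp
    qed
    then obtain y where y: "y \<in> Y" "total_codeg A = 0 \<or> total_codeg A \<le> 2 * (card A - 3) \<or> codeg A y \<ge> 1"
      by blast
    with less.prems have yA: "y \<in> A" by auto
    define Y' where "Y' = {u \<in> A - {y}. E c y u}"
    have tr: "total_codeg A = 2 * codeg A y + total_codeg (A - {y})"
      using total_codeg_remove less.prems yA by blast
    have cY': "card Y' + colour_codeg c A y = card A - 1"
      unfolding Y'_def using card_neighbours less.prems yA by blast
    have cA: "card (A - {y}) = card A - 1" using yA less.prems by simp
    have "\<exists>v vs. v \<in> Y' \<and> alt E (\<not> c) (v # vs) \<and> distinct (v # vs) \<and> set (v # vs) = A - {y}"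
    proof (rule less.hyps)
      show "card (A - {y}) < card A" using cA A2 by linarith
      show "finite (A - {y})" using less.prems by simp
      show "A - {y} \<noteq> {}" using cA A2 by (metis card.empty diff_is_0_eq not_numeral_le_zero numeral_le_one_iff order.trans semiring_norm(69))
      show "Y' \<subseteq> A - {y}" by (auto simp: Y'_def)
      show "total_codeg (A - {y}) + 2 \<le> 2 * card Y'"
        using tr cY' less.prems A2 codeg_colour[of A y c] by linarith
      show "total_codeg (A - {y}) \<le> 2 * (card (A - {y}) - 2)"
        using y(2) tr less.prems A2 unfolding cA by linarith
    qed
    then obtain v vs where v: "v \<in> Y'" "alt E (\<not> c) (v # vs)" "distinct (v # vs)"
      "set (v # vs) = A - {y}" by blast
    then have "alt E c (y # v # vs)" by (simp add: Y'_def)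
    moreover have "distinct (y # v # vs)" using v by auto
    moreover have "set (y # v # vs) = A" using v(4) yA by auto
    ultimately show ?thesis using y(1) by blast
  qed
qed

section \<open>Inserting a pair into an alternating path\<close>

text \<open>The sum skips \<open>v\<close> if \<open>c \<noteq> d\<close>, since then only an insertion before \<open>v\<close> could use its \<open>d\<close>-edges; the
  \<open>of_bool\<close> term records whether the pair could be appended at the last vertex by a \<open>d\<close>-edge.\<close>

lemma insert_pair_after:
  assumes "E (\<not> d) x y" "alt E c (v # vs)"
  shows "(\<exists>ws. alt E c (v # ws) \<and> set ws = {x, y} \<union> set vs \<and> length ws = length vs + 2) \<or>
    (if c = d then length (v # vs) else length vs) + of_bool ((c = d) = even (length vs))
      \<le> (\<Sum>u\<leftarrow>(if c = d then v # vs else vs). missing d u x + missing d u y)"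
  using assms(2)
proof (induction vs arbitrary: v c)
  case Nil
  show ?case
  proof (cases "c = d \<and> (E d v x \<or> E d v y)")
    case True
    then have "alt E c (v # [x, y]) \<or> alt E c (v # [y, x])"
      using assms(1) sym[of "\<not> d" x y] by auto
    moreover have "set [x, y] = {x, y} \<union> set []" "set [y, x] = {x, y} \<union> set []" by auto
    moreover have "length [x, y] = length [] + 2" "length [y, x] = length [] + 2" by auto
    ultimately show ?thesis by blast
  next
    case False
    then show ?thesis by (auto simp: missing_def)
  qed
next
  case (Cons u us)
  have vu: "E c v u" and rest: "alt E (\<not> c) (u # us)" using Cons.prems by auto
  let ?ext = "\<exists>ws. alt E c (v # ws) \<and> set ws = {x, y} \<union> set (u # us) \<and> length ws = length (u # us) + 2"
  consider (ext) ws where "alt E (\<not> c) (u # ws)" "set ws = {x, y} \<union> set us" "length ws = length us + 2"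
    | (count) "(if (\<not> c) = d then length (u # us) else length us) + of_bool (((\<not> c) = d) = even (length us))
      \<le> (\<Sum>u\<leftarrow>(if (\<not> c) = d then u # us else us). missing d u x + missing d u y)"
    using Cons.IH[OF rest] by blast
  then show ?case
  proof cases
    case ext
    then have ?ext using vu by (intro exI[of _ "u # ws"]) auto
    then show ?thesis by blast
  next
    case count
    show ?thesis
    proof (cases "c = d")
      case False
      with count show ?thesis by auto
    next
      case True
      show ?thesis
      proof (cases "E d v x \<and> E d y u \<or> E d v y \<and> E d x u")
        case True
        then have "alt E c (v # x # y # u # us) \<or> alt E c (v # y # x # u # us)"
          using assms(1) sym[of "\<not> d" x y] rest \<open>c = d\<close> by auto
        moreover have "set (x # y # u # us) = {x, y} \<union> set (u # us)"
          "set (y # x # u # us) = {x, y} \<union> set (u # us)" by auto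
        moreover have "length (x # y # u # us) = length (u # us) + 2"
          "length (y # x # u # us) = length (u # us) + 2" by auto
        ultimately show ?thesis by blast
      next
        case False
        then have "2 \<le> missing d v x + missing d v y + missing d u x + missing d u y"
          using sym[of d] by (auto simp: missing_def)
        with count \<open>c = d\<close> show ?thesis by auto
      qed
    qed
  qed
qed

text \<open>The \<open>d\<close>-edges of the path form a matching that can leave only end vertices
  uncovered. If no detour through \<open>x\<close> and \<open>y\<close> can replace a matching edge,
  its two ends together miss at least two \<open>d\<close>-edges to the pair, one per vertex. An
  uncovered end to which the pair cannot be attached misses both, hence one more. The two
  \<open>of_bool\<close> terms count the uncovered ends, first and last.\<close>

lemma insert_pair:
  assumes "E (\<not> d) x y" "alt E c vs" "vs \<noteq> []"
  shows "(\<exists>c' ws. alt E c' ws \<and> set ws = {x, y} \<union> set vs \<and> length ws = length vs + 2) \<or>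
    length vs + of_bool (c \<noteq> d) + of_bool ((c = d) = odd (length vs))
      \<le> (\<Sum>u\<leftarrow>vs. missing d u x + missing d u y)"
proof -
  obtain v us where vs: "vs = v # us" using assms(3) by (cases vs) auto
  consider (ext) ws where "alt E c (v # ws)" "set ws = {x, y} \<union> set us" "length ws = length us + 2"
    | (count) "(if c = d then length (v # us) else length us) + of_bool ((c = d) = even (length us))
      \<le> (\<Sum>u\<leftarrow>(if c = d then v # us else us). missing d u x + missing d u y)"
    using insert_pair_after[OF assms(1), of c v us] assms(2) unfolding vs by blast
  then show ?thesis
  proof cases
    case ext
    then show ?thesis unfolding vs by (intro disjI1 exI[of _ c] exI[of _ "v # ws"]) auto
  next
    case count
    show ?thesis
    proof (cases "c \<noteq> d \<and> (E d v x \<or> E d v y)")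
      case True
      then have "alt E c (y # x # vs) \<or> alt E c (x # y # vs)"
        using assms sym[of "\<not> d" x y] sym[of d v] unfolding vs by auto
      moreover have "set (y # x # vs) = {x, y} \<union> set vs" "set (x # y # vs) = {x, y} \<union> set vs" by auto
      moreover have "length (y # x # vs) = length vs + 2" "length (x # y # vs) = length vs + 2" by auto
      ultimately show ?thesis by blast
    next
      case False
      with count show ?thesis unfolding vs by (auto simp: missing_def)
    qed
  qed
qed

lemma ham_insert_pair:
  assumes "finite A" "x \<in> A" "y \<in> A" "x \<noteq> y" "A - {x, y} \<noteq> {}" "ham E (A - {x, y})"
  shows "E (\<not> d) x y \<Longrightarrow> ham E A \<or> card A - 2 \<le> colour_codeg d (A - {y}) x + colour_codeg d (A - {x}) y"
    and "E True x y \<Longrightarrow> E False x y \<Longrightarrow> ham E A \<or> 2 * card A - 2 \<le> codeg (A - {y}) x + codeg (A - {x}) y"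
proof -
  obtain c vs where vs: "alt E c vs" "distinct vs" "set vs = A - {x, y}"
    using assms(6)[unfolded ham_def] by (elim exE conjE)
  have ne: "vs \<noteq> []" using assms(5) vs(3) by (metis set_empty)
  have "card (A - {x, y}) = card A - card {x, y}" using assms(1-4) by (intro card_Diff_subset) auto
  then have len: "length vs = card A - 2"
    using distinct_card[OF vs(2)] vs(3) assms(4) by simp
  have "card {x, y} \<le> card A" using assms(1-3) by (intro card_mono) auto
  then have A2: "2 \<le> card A" using assms(4) by simp
  have hamI: "ham E A" if "alt E c' ws" "set ws = {x, y} \<union> set vs" "length ws = length vs + 2" for c' ws
  proof -
    have ws: "set ws = A" unfolding that(2) vs(3) using assms(2,3) by blast
    have "length ws = card A" using that(3) len A2 by simp
    then have "distinct ws" using ws by (simp add: card_distinct)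
    with that(1) ws show ?thesis unfolding ham_def by blast
  qed
  have sums: "(\<Sum>u\<leftarrow>vs. missing d u x + missing d u y) = colour_codeg d (A - {y}) x + colour_codeg d (A - {x}) y" for d
  proof -
    have "A - {y} - {x} = set vs" "A - {x} - {y} = set vs" using vs(3) by auto
    then show ?thesis
      using vs(2) by (simp add: sum_list_distinct_conv_sum_set sum.distrib colour_codeg_def missing_sym[of _ x] missing_sym[of _ y])
  qed
  have ins: "ham E A \<or> card A - 2 + of_bool (c \<noteq> d) + of_bool ((c = d) = odd (card A - 2))
      \<le> colour_codeg d (A - {y}) x + colour_codeg d (A - {x}) y" if "E (\<not> d) x y" for d
    using insert_pair[OF that vs(1) ne, unfolded sums] hamI unfolding len by blast
  show "ham E A \<or> card A - 2 \<le> colour_codeg d (A - {y}) x + colour_codeg d (A - {x}) y" if "E (\<not> d) x y"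
    using ins[OF that] by linarith
  \<comment> \<open>Over the two colours, each \<open>of_bool\<close> term equals 1 exactly once, so
    the bounds add up to 2(n - 2) + 2.\<close>
  show "ham E A \<or> 2 * card A - 2 \<le> codeg (A - {y}) x + codeg (A - {x}) y" if "E True x y" "E False x y"
    using ins[of True] ins[of False] that A2 unfolding codeg_def
    by (cases c; cases "even (card A - 2)"; simp; linarith)
qed

section \<open>Passing from n - 2 to n vertices\<close>

lemma even_total_codeg: "finite A \<Longrightarrow> even (total_codeg A)"
proof (induction A rule: finite_induct)
  case (insert x A)
  then show ?case using total_codeg_remove[of "insert x A" x] by simp
qed (simp add: total_codeg_def)

lemma total_codeg_mono_remove: "finite A \<Longrightarrow> total_codeg (A - {x}) \<le> total_codeg A"
  using total_codeg_remove[of A x] by (cases "x \<in> A") auto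

lemma codeg_remove_adjacent:
  assumes "finite A" "x \<in> A" "x \<noteq> y" "E True x y" "E False x y"
  shows "codeg (A - {x}) y = codeg A y"
  using assms colour_codeg_remove[of A x y] sym[of _ x y] by (simp add: codeg_def missing_def)

text \<open>No edge between \<open>x\<close> and \<open>y\<close> is missing, so the 2n - 2 missing
  edges that block every insertion are distinct, while at most 2n - 4 exist.\<close>

lemma ham_doubly_adjacent_pair:
  assumes "finite A" "x \<in> A" "y \<in> A" "x \<noteq> y" "E True x y" "E False x y" "3 \<le> card A"
    and "ham E (A - {x, y})" and "total_codeg A \<le> 2 * (2 * card A - 4)"
  shows "ham E A"
proof (rule ccontr)
  assume no: "\<not> ham E A"
  have "A - {x, y} \<noteq> {}"
  proof
    assume "A - {x, y} = {}"
    then have "card A \<le> card {x, y}" by (intro card_mono) auto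
    with assms(4,7) show False by simp
  qed
  then have "2 * card A - 2 \<le> codeg (A - {y}) x + codeg (A - {x}) y"
    using ham_insert_pair(2)[OF assms(1-4) _ assms(8,5,6)] no by blast
  moreover have "codeg (A - {y}) x = codeg A x" "codeg (A - {x}) y = codeg A y"
    using codeg_remove_adjacent assms sym by metis+
  moreover have "2 * codeg A x + 2 * codeg (A - {x}) y \<le> total_codeg A"
    using total_codeg_remove[of A x] total_codeg_remove[of "A - {x}" y] assms by simp
  ultimately show False using assms by linarith
qed

text \<open>At least n - 1 missing edges meet \<open>x\<close>, which leaves at most n - 3 in
  \<open>?H\<close>. Let \<open>c\<close> be a colour missing least often at \<open>x\<close>. If
  \<open>x\<close> has at most one neighbour in the other colour, a \<open>c\<close>-edge from
  \<open>x\<close> leads into a greedy path of \<open>?H\<close>. Otherwise two such neighbours are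
  available as partners of \<open>x\<close>, and they cannot both fail.\<close>

lemma ham_no_doubly_adjacent_vertex:
  assumes fin: "finite A" and x: "x \<in> A" and n: "3 \<le> card A" and tot: "total_codeg A \<le> 2 * (2 * card A - 4)"
    and no_double: "\<And>y. y \<in> A - {x} \<Longrightarrow> \<not> (E True x y \<and> E False x y)"
    and IH: "\<And>y. y \<in> A - {x} \<Longrightarrow> total_codeg (A - {x, y}) \<le> 2 * (card A - 3) \<Longrightarrow> ham E (A - {x, y})"
  shows "ham E A"
proof -
  let ?n = "card A"
  let ?H = "A - {x}"
  obtain c where c: "colour_codeg c A x \<le> colour_codeg (\<not> c) A x"
    by (cases "colour_codeg True A x \<le> colour_codeg False A x") (auto intro: that[of True] that[of False])
  define N where "N = {u \<in> ?H. E c x u}"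
  have N: "card N + colour_codeg c A x = ?n - 1" unfolding N_def using card_neighbours fin x by blast
  have finH: "finite ?H" "card ?H = ?n - 1" using fin x by auto
  have tr: "total_codeg A = 2 * (colour_codeg c A x + colour_codeg (\<not> c) A x) + total_codeg ?H"
    using total_codeg_remove[OF fin x] codeg_colour[of A x c] by simp
  have deg: "?n - 1 \<le> colour_codeg c A x + colour_codeg (\<not> c) A x"
  proof -
    have "(\<Sum>u\<in>?H. 1) \<le> (\<Sum>u\<in>?H. missing c x u + missing (\<not> c) x u)"
      using no_double by (intro sum_mono) (cases c; auto simp: missing_def)
    then show ?thesis using finH by (simp add: colour_codeg_def sum.distrib)
  qed
  obtain k where k: "?n = k + 3" using n by (metis add.commute le_Suc_ex)
  have totH: "total_codeg ?H \<le> 2 * (?n - 3)" using tr deg tot unfolding k by simp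
  show ?thesis
  proof (cases "?n - 2 \<le> colour_codeg (\<not> c) A x")
    case True
    have "\<exists>v vs. v \<in> N \<and> alt E (\<not> c) (v # vs) \<and> distinct (v # vs) \<and> set (v # vs) = ?H"
    proof (rule greedy_path)
      have "card ?H \<noteq> 0" using finH k by linarith
      then show "finite ?H" "?H \<noteq> {}" using finH(1) by (auto simp only: card.empty)
      show "N \<subseteq> ?H" by (auto simp: N_def)
      show "total_codeg ?H + 2 \<le> 2 * card N" using tr N True tot unfolding k by simp
      show "total_codeg ?H \<le> 2 * (card ?H - 2)" using totH finH by simp
    qed
    then obtain v vs where v: "v \<in> N" "alt E (\<not> c) (v # vs)" "distinct (v # vs)" "set (v # vs) = ?H"
      by blast
    then have "alt E c (x # v # vs)" by (simp add: N_def)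
    moreover have "distinct (x # v # vs)" using v by auto
    moreover have "set (x # v # vs) = A" using v(4) x by auto
    ultimately show ?thesis unfolding ham_def by blast
  next
    case False
    let ?N = "{u \<in> ?H. E (\<not> c) x u}"
    have "card ?N + colour_codeg (\<not> c) A x = ?n - 1" using card_neighbours fin x by blast
    then have "2 \<le> card ?N" using False n by linarith
    then obtain S where "S \<subseteq> ?N" "card S = 2" by (meson obtain_subset_with_card_n)
    then obtain y z where yz: "y \<in> ?N" "z \<in> ?N" "y \<noteq> z" by (auto simp: card_2_iff)
    \<comment> \<open>The \<open>c\<close>-edge from \<open>x\<close> to \<open>u\<close> is missing
      but does not count against the insertion, hence the \<open>- 1\<close>; the last conjunct
      makes this subtraction exact.\<close>
    have one: "ham E A \<or> ?n - 2 \<le> colour_codeg c A x - 1 + colour_codeg c ?H u \<and> 1 \<le> colour_codeg c A x" if "u \<in> ?N" for u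
    proof -
      have u: "u \<in> A" "x \<noteq> u" "E (\<not> c) x u" "u \<in> ?H" using that by auto
      have "\<not> E c x u" using no_double[OF u(4)] u(3) by (cases c) auto
      then have "colour_codeg c A x = 1 + colour_codeg c (A - {u}) x"
        using colour_codeg_remove[of A u x c] fin u by (simp add: missing_def)
      moreover have eq: "?H - {u} = A - {x, u}" by auto
      have "ham E (A - {x, u})"
        using IH[OF u(4)] total_codeg_mono_remove[of ?H u] totH fin unfolding eq by simp
      moreover have "A - {x, u} \<noteq> {}"
        using yz x by (cases "u = y") auto
      ultimately show ?thesis using ham_insert_pair(1)[OF fin x u(1,2) _ _ u(3)] by auto
    qed
    \<comment> \<open>Only a missing \<open>c\<close>-edge between \<open>y\<close> and
      \<open>z\<close> is counted at both, hence the extra 2.\<close>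
    have "2 * (colour_codeg c ?H y + colour_codeg c ?H z) \<le> total_codeg ?H + 2"
    proof -
      have "2 * codeg ?H y + 2 * codeg (?H - {y}) z \<le> total_codeg ?H"
        using total_codeg_remove[of ?H y] total_codeg_remove[of "?H - {y}" z] finH yz by simp
      moreover have "colour_codeg c ?H z \<le> 1 + colour_codeg c (?H - {y}) z"
        using colour_codeg_remove[of ?H y z c] finH yz by (simp add: missing_def)
      ultimately show ?thesis
        using colour_codeg_le_codeg[of c ?H y] colour_codeg_le_codeg[of c "?H - {y}" z] by simp
    qed
    \<comment> \<open>If both insertions fail, adding their bounds and using the choice of
      \<open>c\<close> gives at least 2n - 3 missing edges in \<open>A\<close>.\<close>
    then show ?thesis using one[OF yz(1)] one[OF yz(2)] tr tot c unfolding k by auto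
  qed
qed

section \<open>Tolerated numbers of missing edges and the induction\<close>

text \<open>The small values are chosen so that the induction step works from \<open>n - 2\<close> to \<open>n\<close> for every \<open>n \<ge> 3\<close>.
  The general value \<open>2 * n - 4\<close> is too large for \<open>n = 5\<close> and \<open>n = 7\<close>: if red misses all edges inside a set of
  4 and 5 vertices, respectively, it has no matching covering all vertices but one.\<close>

definition tolerance :: "nat \<Rightarrow> nat" where
  "tolerance n = (if n \<le> 1 then 0 else if n = 2 then 1 else if n = 3 then 2 else if n = 5 then 5
    else if n = 7 then 9 else 2 * n - 4)"

text \<open>Here \<open>m\<close> stands for the number of missing edges and \<open>d\<close> for
  their maximum degree; both conclusions contradict degree-sum bounds in the induction.
  \<open>tolerance\<close> grows by at most 4 from n - 2 to n, except by 5 at n = 9, so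
  \<open>d\<close> is at most 4.\<close>

lemma tolerance_step:
  assumes "3 \<le> n" "m \<le> tolerance n"
  shows "d + tolerance (n - 2) + 1 \<le> m \<Longrightarrow> (d + 1) * d < 2 * m"
    and "d + tolerance (n - 2) + 2 \<le> m \<Longrightarrow> n * d < 2 * m"
proof -
  have *: "n = 3 \<or> n = 4 \<or> n = 5 \<or> n = 6 \<or> n = 7 \<or> n = 8 \<or> n = 9 \<or> n \<ge> 10" using assms by linarith
  have d: "d = 0 \<or> d = 1 \<or> d = 2 \<or> d = 3 \<or> d = 4" if "d + tolerance (n - 2) + 1 \<le> m"
    using * that assms(2) by (elim disjE) (auto simp: tolerance_def split: if_splits)
  show "(d + 1) * d < 2 * m" if "d + tolerance (n - 2) + 1 \<le> m"
    using * d[OF that] that assms(2) by (elim disjE) (auto simp: tolerance_def split: if_splits)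
  show "n * d < 2 * m" if "d + tolerance (n - 2) + 2 \<le> m"
    using * d that assms(2) by (elim disjE) (auto simp: tolerance_def split: if_splits)
qed

lemma ham_if_total_codeg_le_tolerance:
  assumes "finite A" "A \<noteq> {}" "total_codeg A \<le> 2 * tolerance (card A)"
  shows "ham E A"
  using assms
proof (induction "card A" arbitrary: A rule: less_induct)
  case less
  let ?n = "card A"
  have "?n \<noteq> 0" using less.prems by simp
  then consider "?n = 1" | "?n = 2" | "?n \<ge> 3" by linarith
  then show ?case
  proof cases
    case 1
    then obtain v where "A = {v}" by (auto simp: card_1_singleton_iff)
    then show ?thesis unfolding ham_def by (intro exI[of _ True] exI[of _ "[v]"]) auto
  next
    case 2
    then obtain u v where uv: "A = {u, v}" "u \<noteq> v" by (auto simp: card_2_iff)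
    then have "A - {u} = {v}" "A - {v} = {u}" by auto
    with uv less.prems have "\<exists>c. E c u v"
      using sym[of _ u v] by (auto simp: total_codeg_def codeg_def colour_codeg_def missing_def tolerance_def of_bool_def split: if_splits)
    then obtain c where "E c u v" ..
    then show ?thesis unfolding ham_def using uv
      by (intro exI[of _ c] exI[of _ "[u, v]"]) auto
  next
    case 3
    have tol_le: "tolerance ?n \<le> 2 * ?n - 4" and tol_ge: "?n - 3 \<le> tolerance (?n - 2)" using 3 by (auto simp: tolerance_def)
    have card2: "card (A - {x, y}) = ?n - 2" if "x \<in> A" "y \<in> A - {x}" for x y
    proof -
      have "card {x, y} = 2" using that(2) by auto
      then show ?thesis using that less.prems(1) by (subst card_Diff_subset) auto
    qed
    have IH: "ham E (A - {x, y})" if "x \<in> A" "y \<in> A - {x}" "total_codeg (A - {x, y}) \<le> 2 * tolerance (?n - 2)" for x y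
    proof (rule less.hyps)
      show "card (A - {x, y}) < ?n" using card2[OF that(1,2)] 3 by simp
      show "A - {x, y} \<noteq> {}" using card2[OF that(1,2)] 3 by (metis card.empty diff_is_0_eq not_less_eq_eq numeral_2_eq_2 numeral_3_eq_3)
    qed (use that less.prems card2 in auto)
    have "Max (codeg A ` A) \<in> codeg A ` A" using less.prems by (intro Max_in) auto
    then obtain x where x1: "x \<in> A" "codeg A x = Max (codeg A ` A)" by (elim imageE) simp
    have x: "x \<in> A" "\<And>y. y \<in> A \<Longrightarrow> codeg A y \<le> codeg A x"
      unfolding x1(2) using x1(1) less.prems(1) by (auto intro!: Max_ge)
    show ?thesis
    proof (cases "\<exists>y \<in> A - {x}. E True x y \<and> E False x y")
      case False
      show ?thesis
      proof (rule ham_no_doubly_adjacent_vertex)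
        fix y assume "y \<in> A - {x}" "total_codeg (A - {x, y}) \<le> 2 * (?n - 3)"
        then show "ham E (A - {x, y})" using IH[OF x(1)] tol_ge by auto
      qed (use less.prems False x 3 tol_le in auto)
    next
      case True
      define D where "D = {y \<in> A - {x}. E True x y \<and> E False x y}"
      have D: "D \<noteq> {}" "D \<subseteq> A - {x}" using True by (auto simp: D_def)
      \<comment> \<open>Deleting \<open>x\<close> and such a \<open>y\<close> removes exactly
        \<open>codeg A x + codeg A y\<close> missing edges, so the induction hypothesis applies to
        the rest.\<close>
      have "\<exists>y\<in>D. total_codeg A \<le> 2 * (codeg A x + codeg A y + tolerance (?n - 2))"
      proof (rule ccontr)
        obtain m where m: "total_codeg A = 2 * m" using even_total_codeg less.prems(1) by blast
        assume "\<not> ?thesis"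
        then have far: "codeg A x + codeg A y + tolerance (?n - 2) < m" if "y \<in> D" for y
          using that m by (auto simp: not_le)
        have mtol: "m \<le> tolerance ?n" using m less.prems by simp
        show False
        proof (cases "\<forall>y\<in>D. codeg A y = 0")
          case zero: True
          \<comment> \<open>Each vertex outside \<open>D\<close> other than \<open>x\<close>
            accounts for a missing edge at \<open>x\<close>. So all missing edges lie among at most
            \<open>codeg A x + 1\<close> vertices.\<close>
          have "card (A - {x} - D) = (\<Sum>u\<in>A - {x} - D. 1)" by simp
          also have "\<dots> \<le> (\<Sum>u\<in>A - {x} - D. missing True x u + missing False x u)"
            by (intro sum_mono) (auto simp: D_def missing_def)
          also have "\<dots> \<le> codeg A x"
            unfolding codeg_def colour_codeg_def sum.distrib[symmetric]
            using less.prems by (intro sum_mono2) auto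
          finally have "card (A - {x} - D) + 1 \<le> codeg A x + 1" by simp
          moreover have "A - D = insert x (A - {x} - D)" using D x(1) by blast
          ultimately have le: "card (A - D) \<le> codeg A x + 1"
            using less.prems(1) by (simp only: card_insert_disjoint finite_Diff Diff_iff insertI1) simp
          have "total_codeg A = (\<Sum>y\<in>A - D. codeg A y)"
            unfolding total_codeg_def using zero less.prems by (intro sum.mono_neutral_right) auto
          also have "\<dots> \<le> card (A - D) * codeg A x"
            using x by (intro sum_bounded_above[where 'a = nat, simplified]) auto
          also have "\<dots> \<le> (codeg A x + 1) * codeg A x"
            using le by (intro mult_right_mono) auto
          finally have "2 * m \<le> (codeg A x + 1) * codeg A x" using m by simp
          moreover obtain y where "y \<in> D" using D by auto
          ultimately show False
            using tolerance_step(1)[OF 3 mtol, of "codeg A x"] far[OF \<open>y \<in> D\<close>] by linarith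
        next
          case False
          then obtain y where "y \<in> D" "codeg A y \<noteq> 0" by blast
          \<comment> \<open>A nonzero codegree of \<open>y\<close> gains one more, enough for the
            cruder bound over all n vertices.\<close>
          then have "codeg A x + tolerance (?n - 2) + 2 \<le> m" using far[of y] by linarith
          moreover have "total_codeg A \<le> ?n * codeg A x"
            unfolding total_codeg_def using x by (intro sum_bounded_above[where 'a = nat, simplified]) auto
          ultimately show False using tolerance_step(2)[OF 3 mtol, of "codeg A x"] m by linarith
        qed
      qed
      then obtain y where y: "y \<in> D" "total_codeg A \<le> 2 * (codeg A x + codeg A y + tolerance (?n - 2))" by blast
      then have yA: "y \<in> A" "x \<noteq> y" "E True x y" "E False x y" by (auto simp: D_def)
      have "A - {x} - {y} = A - {x, y}" by auto
      then have "total_codeg A = 2 * codeg A x + 2 * codeg A y + total_codeg (A - {x, y})"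
        using total_codeg_remove[of A x] total_codeg_remove[of "A - {x}" y] codeg_remove_adjacent[of A x y] yA x less.prems
        by simp
      then have "ham E (A - {x, y})" using IH[OF x(1)] y(2) yA by auto
      then show ?thesis
        using ham_doubly_adjacent_pair[of A x y] less.prems x(1) yA 3 tol_le by linarith
    qed
  qed
qed

end

section \<open>Translation to edge-coloured multigraphs\<close>

lemma proper_path_of_alt:
  fixes G :: "('v, 'e, 'c) ec_multigraph"
  assumes E: "\<And>c u v. E c u v \<Longrightarrow> \<exists>e\<in>edges G. ends G e = {u, v} \<and> colour G e = (if c then r else b)"
    and "r \<noteq> b" "alt E c vs" "vs \<noteq> []" "distinct vs" "set vs \<subseteq> verts G"
  shows "\<exists>es. is_proper_path G vs es"
proof -
  \<comment> \<open>Tying the colour to the parity of the index makes prepending an edge a mere flip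
    of \<open>c\<close>.\<close>
  have "\<exists>es. length (v # vs) = Suc (length es) \<and> set es \<subseteq> edges G \<and>
      (\<forall>i<length es. ends G (es ! i) = {(v # vs) ! i, (v # vs) ! Suc i} \<and>
        colour G (es ! i) = (if c = even i then r else b))"
    if "alt E c (v # vs)" for c v vs
    using that
  proof (induction vs arbitrary: c v)
    case Nil
    then show ?case by auto
  next
    case (Cons u us)
    from Cons.prems have "E c v u" "alt E (\<not> c) (u # us)" by auto
    from E[OF this(1)] obtain e where e: "e \<in> edges G" "ends G e = {v, u}"
      "colour G e = (if c then r else b)" by blast
    from Cons.IH[OF \<open>alt E (\<not> c) (u # us)\<close>] obtain es where es:
      "length (u # us) = Suc (length es)" "set es \<subseteq> edges G"
      "\<And>i. i < length es \<Longrightarrow> ends G (es ! i) = {(u # us) ! i, (u # us) ! Suc i} \<and>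
        colour G (es ! i) = (if (\<not> c) = even i then r else b)" by blast
    show ?case
    proof (intro exI[of _ "e # es"] conjI allI impI)
      fix i assume i: "i < length (e # es)"
      show "ends G ((e # es) ! i) = {(v # u # us) ! i, (v # u # us) ! Suc i}"
        using e es(3) i by (cases i) auto
      show "colour G ((e # es) ! i) = (if c = even i then r else b)"
        using e es(3) i by (cases i) auto
    qed (use e es in auto)
  qed
  moreover obtain v us where "vs = v # us" using assms(4) by (cases vs) auto
  ultimately obtain es where es: "length vs = Suc (length es)" "set es \<subseteq> edges G"
      "\<And>i. i < length es \<Longrightarrow> ends G (es ! i) = {vs ! i, vs ! Suc i} \<and>
        colour G (es ! i) = (if c = even i then r else b)"
    using assms(3) by blast
  have "is_proper_path G vs es"
    unfolding is_proper_path_def is_path_def using es assms(2,5,6) by auto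
  then show ?thesis by blast
qed

text \<open>Double counting: each edge yields two triples \<open>(u, v, c)\<close>, one per
  orientation, and \<open>parallel_colours\<close> keeps the triples of different edges
  apart.\<close>

lemma (in edge_coloured_multigraph) card_edges_le:
  assumes C: "C = {r, b}" "r \<noteq> b"
    and E: "\<And>c u v. E c u v \<longleftrightarrow> (\<exists>e\<in>edges G. ends G e = {u, v} \<and> colour G e = (if c then r else b))"
  shows "2 * card (edges G) \<le> (\<Sum>u\<in>verts G. \<Sum>v\<in>verts G - {u}. of_bool (E True u v) + of_bool (E False u v))"
proof -
  let ?V = "verts G"
  define T where "T e = {(u, v, c). {u, v} = ends G e \<and> colour G e = (if c then r else b)}" for e
  define X where "X = (SIGMA u:?V. SIGMA v:?V - {u}. {c. E c u v})"
  have T2: "card (T e) = 2" if e: "e \<in> edges G" for e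
  proof -
    obtain p q where pq: "ends G e = {p, q}" "p \<noteq> q" using card_ends[OF e] by (auto simp: card_2_iff)
    obtain c where "colour G e = (if c then r else b)"
      using colour_in[OF e] C that by (metis insert_iff singletonD)
    then have "T e = {(p, q, c), (q, p, c)}"
      using pq C(2) unfolding T_def by (auto simp: doubleton_eq_iff split: if_splits)
    then show ?thesis using pq by simp
  qed
  have "T e \<inter> T f = {}" if "e \<in> edges G" "f \<in> edges G" "e \<noteq> f" for e f
    using parallel_colours[OF that] by (auto simp: T_def)
  then have "card (\<Union>e\<in>edges G. T e) = (\<Sum>e\<in>edges G. card (T e))"
    using finite_edges T2 by (intro card_UN_disjoint) (auto intro: card_ge_0_finite)
  then have "2 * card (edges G) = card (\<Union>e\<in>edges G. T e)" using T2 by simp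
  also have "\<dots> \<le> card X"
  proof (intro card_mono)
    show "finite X" unfolding X_def using finite_verts by (intro finite_SigmaI) auto
    have "(u, v, c) \<in> X" if e: "e \<in> edges G" and t: "(u, v, c) \<in> T e" for u v c e
    proof -
      have uv: "{u, v} = ends G e" "colour G e = (if c then r else b)" using t by (auto simp: T_def)
      have "u \<noteq> v" using card_ends[OF e] unfolding uv(1)[symmetric] by auto
      moreover have "u \<in> ?V" "v \<in> ?V" using ends_subset[OF e] uv by auto
      ultimately show ?thesis using e uv by (auto simp: X_def E)
    qed
    then show "(\<Union>e\<in>edges G. T e) \<subseteq> X" by auto
  qed
  also have "card X = (\<Sum>u\<in>?V. \<Sum>v\<in>?V - {u}. card {c. E c u v})"
    unfolding X_def using finite_verts by (subst card_SigmaI; simp)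
  also have "\<dots> = (\<Sum>u\<in>?V. \<Sum>v\<in>?V - {u}. of_bool (E True u v) + of_bool (E False u v))"
  proof (intro sum.cong refl)
    fix u v
    have "{c. E c u v} = (if E True u v then {True} else {}) \<union> (if E False u v then {False} else {})"
      by (auto, (metis (full_types))+)
    then show "card {c. E c u v} = of_bool (E True u v) + of_bool (E False u v)" by simp
  qed
  finally show ?thesis .
qed

theorem theorem3p1:
  fixes G :: "('v, 'e, 'c) ec_multigraph"
    and r b :: 'c
    and n m :: nat
  assumes "edge_coloured_multigraph G {r, b}"
    and "r \<noteq> b"
    and "n = card (verts G)"
    and "m = card (edges G)"
    and "n \<ge> 8"
    and "m \<ge> (n choose 2) + ((n - 2) choose 2) + 1"
  shows "has_proper_hamiltonian_path G"
proof -
  interpret edge_coloured_multigraph G "{r, b}" by fact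
  define E where "E c u v \<longleftrightarrow> (\<exists>e\<in>edges G. ends G e = {u, v} \<and> colour G e = (if c then r else b))" for c u v
  interpret two_coloured E
    by unfold_locales (simp add: E_def insert_commute)
  let ?V = "verts G"
  have "total_codeg ?V + (\<Sum>u\<in>?V. \<Sum>v\<in>?V - {u}. of_bool (E True u v) + of_bool (E False u v))
      = (\<Sum>u\<in>?V. \<Sum>v\<in>?V - {u}. 2)"
    unfolding total_codeg_def codeg_def colour_codeg_def sum.distrib[symmetric]
    by (intro sum.cong refl) (simp add: missing_def)
  also have "\<dots> = 2 * (n * (n - 1))" using finite_verts assms(3) by simp
  finally have "total_codeg ?V + 2 * m \<le> 2 * (n * (n - 1))"
    using card_edges_le[OF refl assms(2) E_def] assms(4) by linarith
  moreover have "2 * (a choose 2) = a * (a - 1)" for a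
    by (cases a) (auto simp: choose_two intro!: dvd_mult_div_cancel)
  note this[of n] this[of "n - 2"]
  moreover obtain k where k: "n = k + 8" using assms(5) by (metis add.commute le_Suc_ex)
  ultimately have "total_codeg ?V + (n - 2) * (n - 2 - 1) + 2 \<le> n * (n - 1)"
    using assms(6) by linarith
  \<comment> \<open>The difference n(n - 1) - (n - 2)(n - 3) - 2 equals 2(2n - 4), and n \<ge> 8
    avoids the exceptional values of \<open>tolerance\<close>.\<close>
  then have "total_codeg ?V \<le> 2 * tolerance (card ?V)"
    using assms(3) unfolding k by (simp add: tolerance_def algebra_simps)
  moreover have "?V \<noteq> {}" using assms(3,5) by auto
  ultimately obtain c vs where vs: "alt E c vs" "distinct vs" "set vs = ?V"
    using ham_if_total_codeg_le_tolerance finite_verts unfolding ham_def by blast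
  then have "vs \<noteq> []" using \<open>?V \<noteq> {}\<close> by auto
  then obtain es where "is_proper_path G vs es"
    using proper_path_of_alt[of E G r b c vs] vs assms(2) by (auto simp: E_def)
  then show ?thesis using vs(3) unfolding has_proper_hamiltonian_path_def by blast
qed

end
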